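(* Let $G$ be a graph and $F$ a forest, both on $n$ vertices, and suppose \[ 3\Delta(G)+\ell^*(F)\leq n. \] Then $G$ and $F$ pack, unless $n$ is even, $G=\frac{n}{2}K_2$ (a perfect matching), and $F=K_{1,n-1}$.
   Context: All graphs are finite and simple. $\Delta(G)$ is the maximum degree of $G$. Two graphs $G$ and $H$ on $n$ vertices pack if there is a bijection $f:V(G)\to V(H)$ such that for every edge $uv\in E(G)$, $f(u)f(v)\notin E(H)$. For a forest $F$, the number of excess leaves is $\ell^*(F)=\sum_{v\in V(F)}\max\{\deg_F(v)-2,0\}$ (equivalently, the number of leaves of $F$ minus twice the number of components of $F$ having at least two vertices). *)

theory Defs
  imports "Graph_Theory.Graph_Theory" "HOL-Library.Disjoint_Sets"
begin

text \<open>
  Finite simple graphs are the library's \<^locale>\<open>pair_graph\<close>s: finite, loop-free, symmetric arc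
  relations. An edge $uv$ is the pair of arcs $(u,v)$, $(v,u)$, so the degree of a vertex is its
  \<^const>\<open>out_degree\<close>.
\<close>

abbreviation deg :: "'a pair_pre_digraph \<Rightarrow> 'a \<Rightarrow> nat" where
  "deg G v \<equiv> out_degree (with_proj G) v"

text \<open>Inserting 0 only matters for the graph without vertices.\<close>

definition max_deg :: "'a pair_pre_digraph \<Rightarrow> nat" where
  "max_deg G = Max (insert 0 (deg G ` pverts G))"

text \<open>
  The library's \<^const>\<open>forest\<close> forbids directed cycles, including $u \to v \to u$, so among symmetric
  digraphs it only admits the edgeless ones. In a symmetric digraph the cycles of the underlying
  simple graph are the directed cycles of length at least 3.
\<close>

definition undirected_forest :: "'a pair_pre_digraph \<Rightarrow> bool" where
  "undirected_forest F \<longleftrightarrow>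
     pair_graph F \<and> \<not> (\<exists>c. pre_digraph.cycle (with_proj F) c \<and> 3 \<le> length c)"

text \<open>The truncated subtraction on naturals is $\max\{\deg_F(v)-2,0\}$.\<close>

definition excess_leaves :: "'a pair_pre_digraph \<Rightarrow> nat" where
  "excess_leaves F = (\<Sum>v\<in>pverts F. deg F v - 2)"

definition packs :: "'a pair_pre_digraph \<Rightarrow> 'b pair_pre_digraph \<Rightarrow> bool" where
  "packs G H \<longleftrightarrow>
     (\<exists>f. bij_betw f (pverts G) (pverts H) \<and> (\<forall>(u, v)\<in>parcs G. (f u, f v) \<notin> parcs H))"

text \<open>$G = m K_2$, up to isomorphism: the members of $P$ are the vertex sets of the $m$ copies.\<close>

definition disjoint_K2s :: "nat \<Rightarrow> 'a pair_pre_digraph \<Rightarrow> bool" where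
  "disjoint_K2s m G \<longleftrightarrow>
     (\<exists>P. partition_on (pverts G) P \<and> card P = m \<and> (\<forall>S\<in>P. card S = 2) \<and>
          parcs G = {(u, v). u \<noteq> v \<and> (\<exists>S\<in>P. u \<in> S \<and> v \<in> S)})"

end

theory Submission
  imports Defs
begin

text \<open>
  Induct on the number of edges of \<open>F\<close>: let \<open>u\<close> be a leaf of \<open>F\<close> with neighbour \<open>v\<close> and place \<open>F\<close> so
  that \<open>uv\<close> is the only conflict. Swapping \<open>u\<close> with \<open>w\<close> repairs the placement unless \<open>w\<close> is a
  \<open>G\<close>-neighbour of \<open>v\<close> or an \<open>F\<close>-neighbour of a vertex in the set \<open>Z\<close> of \<open>G\<close>-neighbours of \<open>u\<close>.
  There are at most \<open>3 \<Delta>(G) + \<ell>\<^sup>*(F) \<le> n\<close> such obstructions, two of which are wasted on \<open>u\<close> itself, so if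
  \<open>G\<close> and \<open>F\<close> do not pack, every estimate is tight: \<open>|Z| = \<Delta>(G)\<close>, the vertices in \<open>Z\<close> have
  \<open>F\<close>-degree at least 2 and disjoint \<open>F\<close>-neighbourhoods that miss \<open>v\<close>, and \<open>Z\<close> contains every vertex of
  \<open>F\<close>-degree at least 3.

  If \<open>v\<close> had degree 2 in \<open>F\<close>, with second neighbour \<open>l\<close>, rotating \<open>u\<close>, \<open>v\<close>, \<open>l\<close> would give a packing.
  If \<open>x \<noteq> v\<close> has degree at least 3, then \<open>F - uv + ux\<close> does not pack either, as a packing would place
  \<open>u\<close> away from the \<open>G\<close>-neighbours of \<open>x\<close>. For \<open>\<Delta>(G) \<ge> 2\<close> the forest induced on the vertices of degree
  at least 2 has two vertices \<open>v\<close>, \<open>x\<close> of degree at most 1; moving leaves from \<open>v\<close> to \<open>x\<close> until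
  \<open>v\<close> has degree 2 is a contradiction. For \<open>\<Delta>(G) = 1\<close>, \<open>Z = {v}\<close> forces \<open>F\<close> to be a star.
\<close>

section \<open>Forests and their vertices of low degree\<close>

text \<open>Forests as 1-degenerate graphs, a form of acyclicity that is evidently stable under moving a leaf.\<close>

definition forest_on :: "'a set \<Rightarrow> 'a rel \<Rightarrow> bool" where
  "forest_on W E \<longleftrightarrow> finite W \<and> E \<subseteq> W \<times> W \<and> sym E \<and> irrefl E \<and>
     (\<forall>A\<subseteq>W. A \<noteq> {} \<longrightarrow> (\<exists>v\<in>A. card (E `` {v} \<inter> A) \<le> 1))"

lemma forest_onD:
  assumes "forest_on W E"
  shows "finite W" "E \<subseteq> W \<times> W" "sym E" "irrefl E" "finite E" "finite (E `` A)"
    "\<And>x y. (x, y) \<in> E \<Longrightarrow> (y, x) \<in> E \<and> x \<in> W \<and> y \<in> W \<and> x \<noteq> y"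
proof -
  show *: "finite W" "E \<subseteq> W \<times> W" "sym E" "irrefl E"
    using assms unfolding forest_on_def by auto
  show "finite E" using * finite_subset by blast
  then show "finite (E `` A)" by (rule finite_Image)
  show "\<And>x y. (x, y) \<in> E \<Longrightarrow> (y, x) \<in> E \<and> x \<in> W \<and> y \<in> W \<and> x \<noteq> y"
    using * by (auto dest: symD simp: irrefl_def)
qed

lemma forest_on_low_degree:
  assumes "forest_on W E" "A \<subseteq> W" "A \<noteq> {}"
  obtains v where "v \<in> A" "card (E `` {v} \<inter> A) \<le> 1"
  using assms unfolding forest_on_def by blast

text \<open>Delete one vertex \<open>v\<close> of low degree. By induction the rest has two such
  vertices, and since \<open>v\<close> has at most one neighbour in \<open>A\<close>, one of the two
  is not adjacent to \<open>v\<close> and keeps its degree when \<open>v\<close> returns.\<close>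

lemma forest_on_two_low_degree:
  assumes F: "forest_on W E" and "A \<subseteq> W" "2 \<le> card A"
  shows "\<exists>v\<in>A. \<exists>x\<in>A. v \<noteq> x \<and> card (E `` {v} \<inter> A) \<le> 1 \<and> card (E `` {x} \<inter> A) \<le> 1"
  using assms(2,3)
proof (induction "card A" arbitrary: A rule: less_induct)
  case less
  have finA: "finite A" using less.prems by (metis card.infinite not_numeral_le_zero)
  have "A \<noteq> {}" using less.prems by auto
  then obtain v where v: "v \<in> A" "card (E `` {v} \<inter> A) \<le> 1"
    using forest_on_low_degree[OF F less.prems(1)] by blast
  have cA: "card (A - {v}) = card A - 1" using v finA by simp
  have "\<exists>x\<in>A - {v}. card (E `` {x} \<inter> A) \<le> 1"
  proof (cases "card A = 2")
    case True
    then have c1: "card (A - {v}) = 1" using cA by simp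
    then obtain x where x: "A - {v} = {x}" by (auto simp: card_1_singleton_iff)
    then have "E `` {x} \<inter> A \<subseteq> {v}" using forest_onD(7)[OF F] by blast
    then have "card (E `` {x} \<inter> A) \<le> 1"
      using card_mono[of "{v}"] by fastforce
    then show ?thesis using x by blast
  next
    case False
    then have "2 \<le> card (A - {v})" "card (A - {v}) < card A" "A - {v} \<subseteq> W"
      using cA less.prems by auto
    then obtain x y where xy: "x \<in> A - {v}" "y \<in> A - {v}" "x \<noteq> y"
      "card (E `` {x} \<inter> (A - {v})) \<le> 1" "card (E `` {y} \<inter> (A - {v})) \<le> 1"
      using less.hyps by meson
    have "(x, v) \<notin> E \<or> (y, v) \<notin> E"
    proof (rule ccontr)
      assume "\<not> ?thesis"
      then have "{x, y} \<subseteq> E `` {v} \<inter> A" using forest_onD(7)[OF F] xy by blast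
      then have "card {x, y} \<le> card (E `` {v} \<inter> A)" using finA by (intro card_mono) auto
      then show False using xy(3) v(2) by auto
    qed
    moreover have "E `` {z} \<inter> (A - {v}) = E `` {z} \<inter> A" if "(z, v) \<notin> E" for z
      using that by auto
    ultimately show ?thesis using xy by metis
  qed
  then show ?case using v by blast
qed

section \<open>Placements of a forest in a host graph\<close>

text \<open>
  \<open>W\<close> is the vertex set of the forest, and \<open>R\<close> is the arc relation of \<open>G\<close>, transported to \<open>W\<close> by an
  arbitrary bijection.
\<close>

locale packing_host =
  fixes W :: "'a set" and R :: "'a rel" and D :: nat
  assumes finite_W: "finite W" and R_sub: "R \<subseteq> W \<times> W" and sym_R: "sym R"
    and degree_le: "x \<in> W \<Longrightarrow> card (R `` {x}) \<le> D"
begin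

definition packable :: "'a rel \<Rightarrow> bool" where
  "packable E \<longleftrightarrow> (\<exists>f. bij_betw f W W \<and> (\<forall>x y. (x, y) \<in> E \<longrightarrow> (f x, f y) \<notin> R))"

definition excess :: "'a rel \<Rightarrow> nat" where
  "excess E = (\<Sum>x\<in>W. card (E `` {x}) - 2)"

text \<open>The invariant of the induction: it survives deleting an edge, and also moving a leaf
  between two vertices of degree at least 3.\<close>

definition admissible :: "'a rel \<Rightarrow> bool" where
  "admissible E \<longleftrightarrow> forest_on W E \<and> 3 * D + excess E \<le> card W"

definition star_at :: "'a \<Rightarrow> 'a rel" where
  "star_at v = {v} \<times> (W - {v}) \<union> (W - {v}) \<times> {v}"

lemma packableI:
  assumes "bij_betw f W W" "\<And>x y. (x, y) \<in> E \<Longrightarrow> (f x, f y) \<notin> R"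
  shows "packable E"
  using assms unfolding packable_def by blast

lemma card_preimage_le:
  assumes f: "bij_betw f W W" and x: "x \<in> W"
  shows "card {z \<in> W. (f x, f z) \<in> R} \<le> D"
proof -
  have "card {z \<in> W. (f x, f z) \<in> R} \<le> card (R `` {f x})"
  proof (rule card_inj_on_le[of f])
    show "inj_on f {z \<in> W. (f x, f z) \<in> R}"
      using f by (auto simp: bij_betw_def inj_on_def)
    show "finite (R `` {f x})"
      using R_sub finite_W by (meson finite_Image finite_SigmaI finite_subset)
  qed auto
  also have "\<dots> \<le> D" using degree_le f x by (auto dest: bij_betwE)
  finally show ?thesis .
qed

section \<open>Obstructions to repairing a single conflict\<close>

text \<open>Precompose \<open>f\<close> with the transposition of \<open>u\<close> and
  \<open>w\<close>. Only arcs at \<open>u\<close> or \<open>w\<close> get new images: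
  \<open>uv\<close> lands on \<open>f w\<close>, \<open>f v\<close>, and an arc
  \<open>(z, w)\<close> lands on \<open>f z\<close>, \<open>f u\<close>. If neither kind meets
  \<open>R\<close>, the new placement is a packing.\<close>

lemma not_swappable:
  assumes E: "forest_on W E" and leaf: "E `` {u} = {v}"
    and f: "bij_betw f W W"
    and quasi: "\<And>x y. (x, y) \<in> E \<Longrightarrow> (f x, f y) \<in> R \<Longrightarrow> (x, y) = (u, v) \<or> (x, y) = (v, u)"
    and np: "\<not> packable E" and w: "w \<in> W" "w \<noteq> u" "w \<noteq> v"
  shows "(f v, f w) \<in> R \<or> (\<exists>z. (f u, f z) \<in> R \<and> (z, w) \<in> E)"
proof (rule ccontr)
  assume "\<not> ?thesis"
  then have n1: "(f v, f w) \<notin> R" and n2: "\<And>z. (z, w) \<in> E \<Longrightarrow> (f u, f z) \<notin> R" by auto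
  have uv: "(u, v) \<in> E" using leaf by auto
  note ED = forest_onD(7)[OF E]
  define g where "g = id(u := w, w := u)"
  have "bij_betw g W W"
    using ED[OF uv] w unfolding g_def bij_betw_def inj_on_def by (auto simp: image_def)
  then have "bij_betw (f \<circ> g) W W" using f by (rule bij_betw_trans)
  moreover have "((f \<circ> g) x, (f \<circ> g) y) \<notin> R" if xy: "(x, y) \<in> E" for x y
  proof -
    \<comment> \<open>Since \<open>E\<close> and \<open>R\<close> are symmetric, it is enough to
      look at arcs that start in \<open>u\<close> or \<open>w\<close>.\<close>
    have half: "((f \<circ> g) x, (f \<circ> g) y) \<notin> R" if "(x, y) \<in> E" "x \<in> {u, w}" for x y
    proof (cases "x = u")
      case True
      then have "y = v" using that leaf by auto
      then show ?thesis using True n1 w ED[OF uv] symD[OF sym_R] by (auto simp: g_def)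
    next
      case False
      then have x: "x = w" using that by auto
      then have "y \<noteq> u" using that leaf ED w by blast
      then show ?thesis using n2[of y] x ED[OF that(1)] by (auto simp: g_def)
    qed
    show ?thesis
    proof (cases "x \<in> {u, w} \<or> y \<in> {u, w}")
      case True
      then show ?thesis using half[of x y] half[of y x] ED[OF xy] xy symD[OF sym_R] by blast
    next
      case False
      then show ?thesis using quasi[OF xy] by (auto simp: g_def)
    qed
  qed
  ultimately show False using np packableI by blast
qed

text \<open>If no swap works, the vertices other than \<open>v\<close> are covered by the preimages
  \<open>Y\<close> of the neighbours of \<open>f v\<close> and by the forest neighbourhood
  \<open>U\<close> of \<open>Z\<close>. The degree bound and the excess leave no slack in this
  cover.\<close>

lemma leaf_obstruction:
  assumes adm: "admissible E" and leaf: "E `` {u} = {v}"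
    and f: "bij_betw f W W"
    and quasi: "\<And>x y. (x, y) \<in> E - {(u, v), (v, u)} \<Longrightarrow> (f x, f y) \<notin> R"
    and np: "\<not> packable E"
  defines "Z \<equiv> {z \<in> W. (f u, f z) \<in> R}"
  shows "v \<in> Z" "card Z = D" "\<forall>z\<in>Z. 2 \<le> card (E `` {z})"
    "\<forall>x\<in>W. 3 \<le> card (E `` {x}) \<longrightarrow> x \<in> Z" "v \<notin> E `` Z"
    "\<forall>z\<in>Z. \<forall>z'\<in>Z. z \<noteq> z' \<longrightarrow> E `` {z} \<inter> E `` {z'} = {}"
    "W - {v} \<subseteq> ({y \<in> W. (f v, f y) \<in> R} - {u}) \<union> E `` Z"
proof -
  have E: "forest_on W E" and bound: "3 * D + excess E \<le> card W"
    using adm by (auto simp: admissible_def)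
  note ED = forest_onD(7)[OF E]
  have uvE: "(u, v) \<in> E" using leaf by auto
  note uvW = ED[OF uvE]
  have uvR: "(f u, f v) \<in> R"
  proof (rule ccontr)
    assume "(f u, f v) \<notin> R"
    moreover then have "(f v, f u) \<notin> R" using sym_R by (auto dest: symD)
    ultimately have "\<And>x y. (x, y) \<in> E \<Longrightarrow> (f x, f y) \<notin> R" using quasi by blast
    then show False using np packableI f by blast
  qed
  define Y where "Y = {y \<in> W. (f v, f y) \<in> R}"
  define U where "U = E `` Z"
  have finZ: "finite Z" and finY: "finite Y" and ZW: "Z \<subseteq> W"
    using finite_W by (auto simp: Z_def Y_def)
  have finU: "finite U" unfolding U_def by (rule forest_onD(6)[OF E])
  show vZ: "v \<in> Z" using uvR uvW by (auto simp: Z_def)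
  have uY: "u \<in> Y" using uvR uvW sym_R by (auto simp: Y_def dest: symD)
  have uU: "u \<in> U" using uvW vZ by (auto simp: U_def)
  \<comment> \<open>Omitting \<open>v\<close> costs one element in the count. As \<open>u\<close>
    lies in both \<open>Y\<close> and \<open>U\<close>, dropping it from \<open>Y\<close> wins that
    element back.\<close>
  have cov: "W - {v} \<subseteq> (Y - {u}) \<union> (U - {v})"
  proof
    fix w assume w: "w \<in> W - {v}"
    show "w \<in> (Y - {u}) \<union> (U - {v})"
    proof (cases "w = u")
      case True
      then show ?thesis using uU uvW by auto
    next
      case False
      then have "(f v, f w) \<in> R \<or> (\<exists>z. (f u, f z) \<in> R \<and> (z, w) \<in> E)"
        using not_swappable[OF E leaf f _ np] quasi w by blast
      then show ?thesis using w False ED unfolding Y_def U_def Z_def by blast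
    qed
  qed
  then show "W - {v} \<subseteq> ({y \<in> W. (f v, f y) \<in> R} - {u}) \<union> E `` Z"
    unfolding Y_def U_def by blast
  have cY: "card Y \<le> D" and cZ: "card Z \<le> D"
    using card_preimage_le[OF f] uvW by (auto simp: Y_def Z_def)
  have Dpos: "1 \<le> card Y" using uY finY by (metis One_nat_def Suc_leI card_gt_0_iff empty_iff)
  have "card W - 1 = card (W - {v})" using uvW by simp
  also have "\<dots> \<le> card ((Y - {u}) \<union> (U - {v}))" using cov finY finU by (intro card_mono) auto
  also have "\<dots> \<le> card (Y - {u}) + card (U - {v})" by (rule card_Un_le)
  also have "card (Y - {u}) = card Y - 1" using uY by simp
  finally have lower: "2 * D + excess E \<le> card (U - {v})"
    using bound cY Dpos by linarith
  have le1: "card (U - {v}) \<le> card U" using finU by (intro card_mono) auto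
  have Ueq: "U = (\<Union>z\<in>Z. E `` {z})" by (auto simp: U_def)
  have le2: "card U \<le> (\<Sum>z\<in>Z. card (E `` {z}))"
    unfolding Ueq using finZ by (rule card_UN_le)
  have le3: "(\<Sum>z\<in>Z. card (E `` {z})) \<le> (\<Sum>z\<in>Z. 2 + (card (E `` {z}) - 2))"
    by (rule sum_mono) auto
  have eq3: "(\<Sum>z\<in>Z. 2 + (card (E `` {z}) - 2)) = 2 * card Z + (\<Sum>z\<in>Z. card (E `` {z}) - 2)"
    by (subst sum.distrib) simp
  have le4: "(\<Sum>z\<in>Z. card (E `` {z}) - 2) \<le> excess E"
    unfolding excess_def using finite_W ZW by (intro sum_mono2) auto
  \<comment> \<open>The chain begins and ends with \<open>2 * D + excess E\<close>, so all its links
    are equalities. Each of the remaining claims is proved by showing that its failure makes one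
    link strict.\<close>
  note chain = lower le1 le2 le3 eq3 le4 cZ
  show "card Z = D" using chain by linarith
  show "\<forall>z\<in>Z. 2 \<le> card (E `` {z})"
  proof (rule ccontr)
    assume "\<not> ?thesis"
    then obtain z where "z \<in> Z" "card (E `` {z}) < 2" by auto
    then have "(\<Sum>z\<in>Z. card (E `` {z})) < (\<Sum>z\<in>Z. 2 + (card (E `` {z}) - 2))"
      using finZ by (intro sum_strict_mono_ex1 ballI bexI[of _ z]) linarith+
    then show False using chain by linarith
  qed
  show "\<forall>x\<in>W. 3 \<le> card (E `` {x}) \<longrightarrow> x \<in> Z"
  proof (intro ballI impI, rule ccontr)
    fix x assume x: "x \<in> W" "3 \<le> card (E `` {x})" "x \<notin> Z"
    have "(\<Sum>z\<in>insert x Z. card (E `` {z}) - 2) \<le> excess E"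
      unfolding excess_def using finite_W ZW x by (intro sum_mono2) auto
    then show False using chain x finZ by simp
  qed
  show "v \<notin> E `` Z"
  proof
    assume "v \<in> E `` Z"
    then have "card (U - {v}) < card U" using finU by (intro psubset_card_mono) (auto simp: U_def)
    then show False using chain by linarith
  qed
  show "\<forall>z\<in>Z. \<forall>z'\<in>Z. z \<noteq> z' \<longrightarrow> E `` {z} \<inter> E `` {z'} = {}"
  proof (intro ballI impI, rule ccontr)
    fix z z' assume z: "z \<in> Z" "z' \<in> Z" "z \<noteq> z'" "E `` {z} \<inter> E `` {z'} \<noteq> {}"
    then obtain y where y: "y \<in> E `` {z}" "y \<in> E `` {z'}" by blast
    have fE: "finite (E `` {z})" by (rule forest_onD(6)[OF E])
    \<comment> \<open>The shared neighbour \<open>y\<close> is still supplied by \<open>z'\<close>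
      after it is dropped from the neighbourhood of \<open>z\<close>.\<close>
    have "U = (E `` {z} - {y}) \<union> (\<Union>z\<in>Z - {z}. E `` {z})"
      unfolding Ueq using z y by auto
    then have "card U \<le> card (E `` {z} - {y}) + card (\<Union>z\<in>Z - {z}. E `` {z})"
      using card_Un_le by metis
    also have "\<dots> \<le> card (E `` {z} - {y}) + (\<Sum>z\<in>Z - {z}. card (E `` {z}))"
      using card_UN_le[of "Z - {z}" "\<lambda>z. E `` {z}"] finZ by simp
    also have "\<dots> < card (E `` {z}) + (\<Sum>z\<in>Z - {z}. card (E `` {z}))"
      using card_Diff1_less[OF fE y(1)] by linarith
    also have "\<dots> = (\<Sum>z\<in>Z. card (E `` {z}))"
      using sum.remove[OF finZ z(1), of "\<lambda>z. card (E `` {z})"] by simp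
    finally show False using chain by linarith
  qed
qed

section \<open>Leaf edges and neighbours of degree two\<close>

lemma admissible_remove_edge:
  assumes adm: "admissible E"
  shows "admissible (E - {(u, v), (v, u)})"
proof -
  let ?E = "E - {(u, v), (v, u)}"
  have E: "forest_on W E" and bound: "3 * D + excess E \<le> card W"
    using adm by (auto simp: admissible_def)
  have mono: "card (?E `` {x} \<inter> A) \<le> card (E `` {x} \<inter> A)" for x A
    using forest_onD(6)[OF E] by (intro card_mono) auto
  have "excess ?E \<le> excess E"
    unfolding excess_def using mono[of _ UNIV] by (intro sum_mono diff_le_mono) simp
  moreover have "forest_on W ?E"
    unfolding forest_on_def
  proof (intro conjI allI impI)
    show "finite W" "?E \<subseteq> W \<times> W" "irrefl ?E"
      using forest_onD[OF E] by (auto simp: irrefl_def)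
    show "sym ?E" using forest_onD(3)[OF E] by (auto simp: sym_def)
    fix A assume "A \<subseteq> W" "A \<noteq> {}"
    then obtain v where "v \<in> A" "card (E `` {v} \<inter> A) \<le> 1" by (rule forest_on_low_degree[OF E])
    then show "\<exists>v\<in>A. card (?E `` {v} \<inter> A) \<le> 1" using mono le_trans by blast
  qed
  ultimately show ?thesis using bound by (auto simp: admissible_def)
qed

text \<open>With \<open>l\<close> the second neighbour of \<open>v\<close>, move \<open>u\<close> to
  the place of \<open>v\<close>, \<open>v\<close> to that of \<open>l\<close> and \<open>l\<close>
  to that of \<open>u\<close>. Then \<open>uv\<close> takes the conflict-free place of
  \<open>vl\<close>, and all arcs at \<open>l\<close> are safe because no neighbour of
  \<open>l\<close> other than \<open>v\<close> lies in \<open>Z\<close>, nor does \<open>l\<close>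
  itself.\<close>

lemma packable_if_degree_two:
  assumes adm: "admissible E" and leaf: "E `` {u} = {v}" and deg: "card (E `` {v}) = 2"
    and pack: "packable (E - {(u, v), (v, u)})"
  shows "packable E"
proof (rule ccontr)
  assume np: "\<not> packable E"
  obtain f where f: "bij_betw f W W"
    and quasi: "\<And>x y. (x, y) \<in> E - {(u, v), (v, u)} \<Longrightarrow> (f x, f y) \<notin> R"
    using pack unfolding packable_def by blast
  have E: "forest_on W E" using adm by (auto simp: admissible_def)
  note ED = forest_onD(7)[OF E]
  define Z where "Z = {z \<in> W. (f u, f z) \<in> R}"
  note obs = leaf_obstruction[OF adm leaf f quasi np, folded Z_def, simplified]
  have uvE: "(u, v) \<in> E" using leaf by auto
  have "u \<in> E `` {v}" using ED[OF uvE] by auto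
  moreover obtain a b where "E `` {v} = {a, b}" "a \<noteq> b"
    using deg by (auto simp: card_2_iff)
  ultimately obtain l where l: "E `` {v} = {u, l}" "l \<noteq> u"
    by (metis insertE insert_commute singletonD)
  then have vl: "(v, l) \<in> E" by auto
  \<comment> \<open>\<open>l\<close> is adjacent to \<open>v\<close>, which has no neighbour in
    \<open>Z\<close>. A further neighbour of \<open>l\<close> in \<open>Z\<close> would share
    \<open>l\<close> with \<open>v\<close>, which is itself in \<open>Z\<close>.\<close>
  have lZ: "l \<notin> Z" using obs(5) ED[OF vl] by blast
  have yZ: "y \<notin> Z" if "(l, y) \<in> E" "y \<noteq> v" for y
    using obs(6) obs(1) ED[OF that(1)] that(2) vl by blast
  define g where "g = id(u := v, v := l, l := u)"
  have dist: "u \<noteq> v" "v \<noteq> l" "u \<noteq> l" using ED[OF uvE] ED[OF vl] l by auto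
  have "bij_betw g W W"
    using ED[OF uvE] ED[OF vl] dist unfolding g_def bij_betw_def inj_on_def
    by (auto simp: image_def)
  then have "bij_betw (f \<circ> g) W W" using f by (rule bij_betw_trans)
  moreover have "((f \<circ> g) x, (f \<circ> g) y) \<notin> R" if xy: "(x, y) \<in> E" for x y
  proof -
    have vlR: "(f v, f l) \<notin> R" using quasi[of v l] vl dist by auto
    have ulR: "(f l, f u) \<notin> R" using lZ ED[OF vl] symD[OF sym_R] by (auto simp: Z_def)
    have half: "((f \<circ> g) x, (f \<circ> g) y) \<notin> R" if "(x, y) \<in> E" "x \<in> {u, l}" for x y
    proof (cases "x = u")
      case True
      then have "y = v" using that leaf by auto
      then show ?thesis using True vlR dist by (auto simp: g_def)
    next
      case False
      then have x: "x = l" using that by auto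
      have yu: "y \<noteq> u"
      proof
        assume "y = u"
        then have "l \<in> E `` {u}" using ED[OF that(1)] unfolding x by blast
        then show False unfolding leaf using dist by simp
      qed
      show ?thesis
      proof (cases "y = v")
        case True
        then show ?thesis using x ulR dist symD[OF sym_R] by (auto simp: g_def)
      next
        case False
        then show ?thesis using yZ[of y] x yu that(1) ED[OF that(1)] by (auto simp: g_def Z_def)
      qed
    qed
    show ?thesis
    proof (cases "x \<in> {u, l} \<or> y \<in> {u, l}")
      case True
      then show ?thesis using half[of x y] half[of y x] ED[OF xy] xy symD[OF sym_R] by blast
    next
      case False
      then have "x \<noteq> v" "y \<noteq> v" using l(1) xy ED[OF xy] by auto
      then show ?thesis using quasi[of x y] xy False by (auto simp: g_def)
    qed
  qed
  ultimately show False using np packableI by blast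
qed

section \<open>Moving a leaf to another vertex\<close>

definition move_leaf :: "'a \<Rightarrow> 'a \<Rightarrow> 'a \<Rightarrow> 'a rel \<Rightarrow> 'a rel" where
  "move_leaf u v x E = (E - {(u, v), (v, u)}) \<union> {(u, x), (x, u)}"

text \<open>A packing of the moved forest leaves \<open>uv\<close> as the only possible conflict for
  \<open>E\<close>. If \<open>E\<close> did not pack, the obstruction would put \<open>x\<close>
  into \<open>Z\<close>, but the arc \<open>ux\<close> of the moved forest is free of
  conflict.\<close>

lemma packable_if_move_leaf_packable:
  assumes adm: "admissible E" and leaf: "E `` {u} = {v}"
    and x: "x \<in> W" "3 \<le> card (E `` {x})" and pack: "packable (move_leaf u v x E)"
  shows "packable E"
proof (rule ccontr)
  assume np: "\<not> packable E"
  obtain f where f: "bij_betw f W W"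
    and quasi: "\<And>x' y. (x', y) \<in> move_leaf u v x E \<Longrightarrow> (f x', f y) \<notin> R"
    using pack unfolding packable_def by blast
  have "x \<in> {z \<in> W. (f u, f z) \<in> R}"
    using leaf_obstruction(4)[OF adm leaf f _ np] quasi x unfolding move_leaf_def by blast
  then show False using quasi by (auto simp: move_leaf_def)
qed

context
  fixes E u v x
  assumes E: "forest_on W E" and leaf: "E `` {u} = {v}" and x: "x \<in> W" "x \<noteq> v" "x \<noteq> u"
begin

lemma move_leaf_Image:
  "move_leaf u v x E `` {u} = {x}" "move_leaf u v x E `` {v} = E `` {v} - {u}"
  "move_leaf u v x E `` {x} = insert u (E `` {x})"
  "y \<notin> {u, v, x} \<Longrightarrow> move_leaf u v x E `` {y} = E `` {y}"
proof -
  have "(u, v) \<in> E" using leaf by auto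
  note uv = forest_onD(7)[OF E this]
  show "move_leaf u v x E `` {u} = {x}" using leaf x uv unfolding move_leaf_def by auto
  show "move_leaf u v x E `` {v} = E `` {v} - {u}" using x uv unfolding move_leaf_def by auto
  show "move_leaf u v x E `` {x} = insert u (E `` {x})" using x unfolding move_leaf_def by auto
  show "y \<notin> {u, v, x} \<Longrightarrow> move_leaf u v x E `` {y} = E `` {y}"
    unfolding move_leaf_def by auto
qed

lemma card_move_leaf_Image:
  "card (move_leaf u v x E `` {u}) = 1"
  "card (move_leaf u v x E `` {v}) = card (E `` {v}) - 1"
  "card (move_leaf u v x E `` {x}) = card (E `` {x}) + 1"
proof -
  have "(u, v) \<in> E" using leaf by auto
  note uv = forest_onD(7)[OF E this]
  have "(x, u) \<notin> E" using leaf x forest_onD(7)[OF E] by blast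
  then show "card (move_leaf u v x E `` {u}) = 1"
  "card (move_leaf u v x E `` {v}) = card (E `` {v}) - 1"
  "card (move_leaf u v x E `` {x}) = card (E `` {x}) + 1"
    using uv forest_onD(6)[OF E, of "{x}"] unfolding move_leaf_Image
    by (simp_all add: card_insert_if)
qed

text \<open>In a vertex set that contains \<open>u\<close>, the leaf \<open>u\<close> itself has low
  degree. On a set that avoids \<open>u\<close>, the induced graph has not changed.\<close>

lemma forest_on_move_leaf: "forest_on W (move_leaf u v x E)"
  unfolding forest_on_def
proof (intro conjI allI impI)
  have "(u, v) \<in> E" using leaf by auto
  note uv = forest_onD(7)[OF E this]
  show "finite W" by (rule finite_W)
  show "move_leaf u v x E \<subseteq> W \<times> W" "irrefl (move_leaf u v x E)"
    using forest_onD[OF E] x uv by (auto simp: irrefl_def move_leaf_def)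
  show "sym (move_leaf u v x E)"
    using forest_onD(3)[OF E] by (auto simp: sym_def move_leaf_def)
  fix A assume A: "A \<subseteq> W" "A \<noteq> {}"
  show "\<exists>w\<in>A. card (move_leaf u v x E `` {w} \<inter> A) \<le> 1"
  proof (cases "u \<in> A")
    case True
    have "card (move_leaf u v x E `` {u} \<inter> A) \<le> card {x}"
      unfolding move_leaf_Image by (intro card_mono) auto
    then show ?thesis using True by auto
  next
    case False
    obtain w where w: "w \<in> A" "card (E `` {w} \<inter> A) \<le> 1" using A by (rule forest_on_low_degree[OF E])
    have "move_leaf u v x E `` {w} \<inter> A = E `` {w} \<inter> A"
      using False w(1) by (auto simp: move_leaf_def)
    then show ?thesis using w by (intro bexI[of _ w]) simp_all
  qed
qed

lemma card_move_leaf: "card (move_leaf u v x E) = card E"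
proof -
  have "(u, v) \<in> E" using leaf by auto
  note uv = forest_onD(7)[OF E this]
  have "(u, x) \<notin> E" "(x, u) \<notin> E" using leaf x forest_onD(7)[OF E] by blast+
  then have "card (move_leaf u v x E) = card (E - {(u, v), (v, u)}) + card {(u, x), (x, u)}"
    unfolding move_leaf_def using forest_onD(5)[OF E] by (intro card_Un_disjoint) auto
  also have "card (E - {(u, v), (v, u)}) = card E - card {(u, v), (v, u)}"
    using uv leaf by (intro card_Diff_subset) auto
  also have "card {(u, v), (v, u)} = 2" using uv by auto
  also have "card {(u, x), (x, u)} = 2" using x by auto
  finally have "card (move_leaf u v x E) = card E - 2 + 2" .
  moreover have "card {(u, v), (v, u)} \<le> card E"
    using uv leaf forest_onD(5)[OF E] by (intro card_mono) auto
  ultimately show ?thesis using uv by auto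
qed

text \<open>\<open>v\<close> still has degree at least 2 after its loss, so no subtraction is
  truncated and the loss at \<open>v\<close> equals the gain at \<open>x\<close>.\<close>

lemma excess_move_leaf:
  assumes "3 \<le> card (E `` {v})" "3 \<le> card (E `` {x})"
  shows "excess (move_leaf u v x E) = excess E"
proof -
  have "(u, v) \<in> E" using leaf by auto
  note uv = forest_onD(7)[OF E this]
  have split: "excess E' = (\<Sum>y\<in>W - {u, v, x}. card (E' `` {y}) - 2) + (card (E' `` {u}) - 2)
      + (card (E' `` {v}) - 2) + (card (E' `` {x}) - 2)" for E'
  proof -
    have "excess E' = (\<Sum>y\<in>W - {u, v, x}. card (E' `` {y}) - 2)
        + (\<Sum>y\<in>{u, v, x}. card (E' `` {y}) - 2)"
      unfolding excess_def using uv x finite_W by (intro sum.subset_diff) auto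
    then show ?thesis using uv x by auto
  qed
  have "(\<Sum>y\<in>W - {u, v, x}. card (move_leaf u v x E `` {y}) - 2)
      = (\<Sum>y\<in>W - {u, v, x}. card (E `` {y}) - 2)"
    using move_leaf_Image(4) by (intro sum.cong) auto
  then show ?thesis
    unfolding split[of E] split[of "move_leaf u v x E"] card_move_leaf_Image
    using assms leaf by auto
qed

end

section \<open>Induction on edges and repeated leaf moves\<close>

text \<open>Once the edge is gone, \<open>u\<close> is isolated, whereas a star on at least two
  vertices has no isolated vertex. This rules out the exceptional case of the induction
  hypothesis.\<close>

lemma packable_remove_leaf:
  assumes IH: "\<And>E'. admissible E' \<Longrightarrow> card E' < card E \<Longrightarrow> packable E' \<or> (\<exists>c. E' = star_at c)"
    and adm: "admissible E" and leaf: "E `` {u} = {v}"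
  shows "packable (E - {(u, v), (v, u)})"
proof -
  let ?E = "E - {(u, v), (v, u)}"
  have E: "forest_on W E" using adm by (auto simp: admissible_def)
  have uvE: "(u, v) \<in> E" using leaf by auto
  note uv = forest_onD(7)[OF E this]
  have "card ?E < card E" using uvE forest_onD(5)[OF E] by (intro psubset_card_mono) auto
  then have "packable ?E \<or> (\<exists>c. ?E = star_at c)"
    using IH admissible_remove_edge[OF adm] by blast
  moreover have "?E \<noteq> star_at c" for c
  proof
    assume eq: "?E = star_at c"
    have "\<exists>y. (u, y) \<in> star_at c" using uv by (cases "u = c") (auto simp: star_at_def)
    then show False using leaf unfolding eq[symmetric] by auto
  qed
  ultimately show ?thesis by blast
qed

lemma leaf_neighbour:
  assumes E: "forest_on W E" and "2 \<le> card (E `` {v})"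
    and "card {y \<in> E `` {v}. 2 \<le> card (E `` {y})} \<le> 1"
  obtains u where "E `` {u} = {v}"
proof -
  have "{y \<in> E `` {v}. 2 \<le> card (E `` {y})} \<noteq> E `` {v}" using assms by force
  then obtain u where u: "(v, u) \<in> E" "card (E `` {u}) < 2" using not_less by blast
  then have vu: "v \<in> E `` {u}" using forest_onD(7)[OF E] by blast
  then have "card (E `` {u}) \<noteq> 0" using forest_onD(6)[OF E, of "{u}"] by (auto simp del: Image_singleton_iff)
  then have "card (E `` {u}) = 1" using u(2) by linarith
  then have "E `` {u} = {v}" using vu by (metis card_1_singletonE singletonD)
  then show ?thesis by (rule that)
qed

text \<open>Induction on the surplus \<open>k\<close> of the degree of \<open>v\<close> over 2. As
  \<open>v\<close> has at most one neighbour that is not a leaf, there is always a leaf to move to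
  \<open>x\<close>. Moves preserve the number \<open>m\<close> of arcs, so the hypothesis on smaller
  forests stays available until degree two is reached.\<close>

lemma packable_by_moving_leaves:
  assumes "\<And>E'. admissible E' \<Longrightarrow> card E' < m \<Longrightarrow> packable E' \<or> (\<exists>c. E' = star_at c)"
    and "admissible E" "card E = m" "x \<in> W" "x \<noteq> v" "3 \<le> card (E `` {x})"
    and "card {y \<in> E `` {v}. 2 \<le> card (E `` {y})} \<le> 1" "card (E `` {v}) = k + 2"
  shows "packable E"
  using assms(2-)
proof (induction k arbitrary: E)
  case (0 E)
  have E: "forest_on W E" using 0 by (auto simp: admissible_def)
  obtain u where leaf: "E `` {u} = {v}" using leaf_neighbour[OF E _ 0(6)] 0(7) by auto
  have "packable (E - {(u, v), (v, u)})"
    using packable_remove_leaf[OF _ 0(1) leaf] assms(1) 0(2) by blast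
  then show ?case using packable_if_degree_two[OF 0(1) leaf] 0(7) by simp
next
  case (Suc k E)
  let ?E = "\<lambda>u. move_leaf u v x E"
  have E: "forest_on W E" using Suc.prems by (auto simp: admissible_def)
  obtain u where leaf: "E `` {u} = {v}" using leaf_neighbour[OF E _ Suc.prems(6)] Suc.prems(7) by auto
  have xu: "x \<noteq> u" using leaf Suc.prems(5) by auto
  have deg_v: "3 \<le> card (E `` {v})" using Suc.prems by simp
  note move = E leaf Suc.prems(3,4) xu
  have "packable (?E u)"
  proof (rule Suc.IH)
    show "admissible (?E u)"
      using Suc.prems(1) forest_on_move_leaf[OF move] excess_move_leaf[OF move deg_v Suc.prems(5)]
      by (simp add: admissible_def)
    show "card (?E u) = m" using card_move_leaf[OF move] Suc.prems(2) by simp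
    show "3 \<le> card (?E u `` {x})" "card (?E u `` {v}) = k + 2"
      using card_move_leaf_Image[OF move] Suc.prems(5,7) by simp_all
    \<comment> \<open>Only \<open>x\<close> gains a neighbour, and it was not a leaf before; so
      \<open>v\<close> acquires no new non-leaf neighbour.\<close>
    have "{y \<in> ?E u `` {v}. 2 \<le> card (?E u `` {y})} \<subseteq> {y \<in> E `` {v}. 2 \<le> card (E `` {y})}"
    proof
      fix y assume y: "y \<in> {y \<in> ?E u `` {v}. 2 \<le> card (?E u `` {y})}"
      then have yv: "(v, y) \<in> E" "y \<noteq> u" using move_leaf_Image(2)[OF move] by auto
      then have "y \<noteq> v" using forest_onD(7)[OF E] by blast
      then have "2 \<le> card (E `` {y})"
        using y yv Suc.prems(5) move_leaf_Image(4)[OF move, of y] by (cases "y = x") auto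
      then show "y \<in> {y \<in> E `` {v}. 2 \<le> card (E `` {y})}" using yv by blast
    qed
    then have "card {y \<in> ?E u `` {v}. 2 \<le> card (?E u `` {y})} \<le> card {y \<in> E `` {v}. 2 \<le> card (E `` {y})}"
      using forest_onD(6)[OF E, of "{v}"] by (intro card_mono finite_Collect_conjI) (auto simp: Image_def)
    then show "card {y \<in> ?E u `` {v}. 2 \<le> card (?E u `` {y})} \<le> 1"
      using Suc.prems(6) by linarith
  qed (use Suc.prems in auto)
  then show ?case
    using packable_if_move_leaf_packable[OF Suc.prems(1) leaf Suc.prems(3,5)] by blast
qed

section \<open>Stars and the main induction\<close>

text \<open>An edge \<open>ab\<close> that avoids \<open>v\<close> would form a triangle with
  \<open>v\<close>, and a triangle has no vertex of degree at most 1.\<close>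

lemma star_if_dominating:
  assumes E: "forest_on W E" and "v \<in> W" and dom: "W - {v} \<subseteq> E `` {v}"
  shows "E = star_at v"
proof -
  note ED = forest_onD(7)[OF E]
  have "False" if ab: "(a, b) \<in> E" "a \<noteq> v" "b \<noteq> v" for a b
  proof -
    have abW: "a \<in> W" "b \<in> W" "a \<noteq> b" "(b, a) \<in> E" using ED[OF ab(1)] by auto
    then have va: "(v, a) \<in> E" "(v, b) \<in> E" using dom ab by auto
    have two: "2 \<le> card (E `` {w} \<inter> {v, a, b})" if "p \<noteq> q" "{p, q} \<subseteq> E `` {w} \<inter> {v, a, b}" for w p q
    proof -
      have "card {p, q} \<le> card (E `` {w} \<inter> {v, a, b})" using that by (intro card_mono) auto
      then show ?thesis using that by simp
    qed
    have "2 \<le> card (E `` {w} \<inter> {v, a, b})" if "w \<in> {v, a, b}" for w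
      using that two[of a b v] two[of v b a] two[of v a b] ED[OF va(1)] ED[OF va(2)] va ab abW by blast
    moreover obtain w where "w \<in> {v, a, b}" "card (E `` {w} \<inter> {v, a, b}) \<le> 1"
      using forest_on_low_degree[OF E, of "{v, a, b}"] abW assms(2) by blast
    ultimately show False by fastforce
  qed
  then have "(a, b) \<in> star_at v" if "(a, b) \<in> E" for a b
    using that ED[OF that] unfolding star_at_def by blast
  moreover have "star_at v \<subseteq> E"
  proof -
    have "(v, y) \<in> E \<and> (y, v) \<in> E" if "y \<in> W - {v}" for y using dom that ED by blast
    then show ?thesis unfolding star_at_def by blast
  qed
  ultimately show ?thesis by auto
qed

text \<open>Place the centre on the isolated vertex \<open>x\<close> of the host.\<close>

lemma star_packable:
  assumes v: "v \<in> W" and x: "x \<in> W" "R `` {x} = {}"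
  shows "packable (star_at v)"
proof (rule packableI)
  let ?g = "id(v := x, x := v)"
  show "bij_betw ?g W W"
    using v x unfolding bij_betw_def inj_on_def by (auto simp: image_def)
  have no: "(x, y) \<notin> R" "(y, x) \<notin> R" for y using x sym_R by (auto dest: symD)
  show "(?g a, ?g b) \<notin> R" if "(a, b) \<in> star_at v" for a b
  proof -
    have "?g v = x" by simp
    then show ?thesis using that no unfolding star_at_def by (metis (no_types, lifting) Un_iff mem_Sigma_iff singletonD)
  qed
qed

text \<open>The exceptional case also records that the host is 1-regular, from which the perfect
  matching is later recovered.\<close>

lemma packable_or_star:
  assumes "admissible E"
  shows "packable E \<or> (\<exists>c\<in>W. E = star_at c \<and> (\<forall>x\<in>W. card (R `` {x}) = 1))"
  using assms
proof (induction "card E" arbitrary: E rule: less_induct)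
  case less
  have E: "forest_on W E" using less.prems by (auto simp: admissible_def)
  note ED = forest_onD(7)[OF E]
  have IH: "packable E' \<or> (\<exists>c. E' = star_at c)" if "admissible E'" "card E' < card E" for E'
    using less.hyps that by blast
  show ?case
  proof (cases "E = {} \<or> packable E")
    case True
    then show ?thesis using packableI[of id E] by auto
  next
    case False
    then have np: "\<not> packable E" and "E \<noteq> {}" by auto
    then have "{x \<in> W. E `` {x} \<noteq> {}} \<noteq> {}" using ED by fastforce
    \<comment> \<open>A vertex of low degree among the non-isolated vertices is a leaf.\<close>
    then obtain u where u: "u \<in> W" "E `` {u} \<noteq> {}" "card (E `` {u} \<inter> {x \<in> W. E `` {x} \<noteq> {}}) \<le> 1"
      using forest_on_low_degree[OF E, of "{x \<in> W. E `` {x} \<noteq> {}}"] by blast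
    have "E `` {u} \<inter> {x \<in> W. E `` {x} \<noteq> {}} = E `` {u}" using ED by blast
    then have "card (E `` {u}) = 1" using u forest_onD(6)[OF E, of "{u}"]
      by (metis One_nat_def card_0_eq le_Suc_eq le_zero_eq)
    then obtain v where leaf: "E `` {u} = {v}" by (auto simp: card_1_singleton_iff)
    then have "(u, v) \<in> E" by auto
    note uv = ED[OF this]
    obtain f where f: "bij_betw f W W"
      and quasi: "\<And>x y. (x, y) \<in> E - {(u, v), (v, u)} \<Longrightarrow> (f x, f y) \<notin> R"
      using packable_remove_leaf[OF IH less.prems leaf] unfolding packable_def by blast
    define Z where "Z = {z \<in> W. (f u, f z) \<in> R}"
    define Y where "Y = {y \<in> W. (f v, f y) \<in> R}"
    have finZ: "finite Z" and finY: "finite Y" using finite_W by (auto simp: Z_def Y_def)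
    have obs: "v \<in> Z" "card Z = D" "\<forall>z\<in>Z. 2 \<le> card (E `` {z})" "W - {v} \<subseteq> (Y - {u}) \<union> E `` Z"
      using leaf_obstruction[OF less.prems leaf f quasi np] by (simp_all add: Z_def Y_def)
    show ?thesis
    proof (cases "D \<le> 1")
      case True
      then have "Z = {v}" using obs(1,2) finZ by (metis card_le_Suc0_iff_eq One_nat_def
            is_singletonI' is_singleton_the_elem singletonD ex_in_conv)
      moreover have "Y - {u} = {}"
      proof -
        have "card Y \<le> Suc 0" using card_preimage_le[OF f, of v] uv True by (simp add: Y_def)
        moreover have "u \<in> Y" using obs(1) uv sym_R by (auto simp: Y_def Z_def dest: symD)
        ultimately show ?thesis using finY by (auto simp: card_le_Suc0_iff_eq)
      qed
      \<comment> \<open>The cover of \<open>W - {v}\<close> has shrunk to the forest neighbourhood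
        of \<open>v\<close> alone.\<close>
      ultimately have star: "E = star_at v" using star_if_dominating[OF E] uv obs(4) by auto
      moreover have "card (R `` {x}) = 1" if "x \<in> W" for x
      proof -
        have "R `` {x} \<noteq> {}" using star_packable[of v x] uv that np star by auto
        moreover have "finite (R `` {x})"
          using R_sub finite_W by (meson finite_Image finite_SigmaI finite_subset)
        ultimately have "card (R `` {x}) \<noteq> 0" by simp
        then show ?thesis using degree_le[OF that] True by linarith
      qed
      ultimately show ?thesis using uv by blast
    next
      case False
      \<comment> \<open>\<open>M\<close> consists of the non-leaves among the non-isolated vertices.
        It contains \<open>Z\<close>, which now has at least two elements.\<close>
      define M where "M = {y \<in> W. 2 \<le> card (E `` {y})}"
      have "Z \<subseteq> M" using obs(3) by (auto simp: M_def Z_def)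
      then have "card Z \<le> card M" using finite_W by (intro card_mono) (auto simp: M_def)
      then have "2 \<le> card M" using False obs(2) by linarith
      then obtain a b where ab: "a \<in> M" "b \<in> M" "a \<noteq> b"
        "card (E `` {a} \<inter> M) \<le> 1" "card (E `` {b} \<inter> M) \<le> 1"
        using forest_on_two_low_degree[OF E, of M] by (auto simp: M_def)
      have nonleaf: "{y \<in> E `` {c}. 2 \<le> card (E `` {y})} = E `` {c} \<inter> M" for c
        using ED by (auto simp: M_def)
      have big: "3 \<le> card (E `` {c})" if c: "c \<in> M" "card (E `` {c} \<inter> M) \<le> 1" for c
      proof -
        have ge: "2 \<le> card (E `` {c})" using c by (auto simp: M_def)
        then obtain w where w: "E `` {w} = {c}"
          using leaf_neighbour[OF E, of c] c nonleaf by metis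
        have "card (E `` {c}) \<noteq> 2"
          using packable_if_degree_two[OF less.prems w] np packable_remove_leaf[OF IH less.prems w] by blast
        then show ?thesis using ge by simp
      qed
      \<comment> \<open>Leaves are moved from \<open>a\<close> to \<open>b\<close>; the surplus
        \<open>card - 2\<close> is the number of moves.\<close>
      have "card (E `` {a}) = (card (E `` {a}) - 2) + 2" using big ab by fastforce
      then have "packable E"
        using packable_by_moving_leaves[OF IH less.prems refl, of b a] ab big nonleaf
        by (auto simp: M_def)
      then show ?thesis using np by blast
    qed
  qed
qed

end

section \<open>From cycle-free graphs to 1-degenerate relations\<close>

text \<open>Cycles are lists of arcs, while a longest path is handled as a list of vertices; zipping
  such a list with its tail links the two.\<close>

lemma walk_of_vertex_list:
  assumes "successively (\<lambda>a b. (a, b) \<in> E) (x # ys)"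
  defines "p \<equiv> zip (x # ys) ys"
  shows "set p \<subseteq> E" "pcas x p (last (x # ys))" "pawalk_verts x p = x # ys"
  using assms(1) unfolding p_def by (induction ys arbitrary: x) auto

text \<open>If all degrees within \<open>A\<close> were at least 2, the first vertex
  \<open>x\<close> of a longest path in \<open>A\<close> would have a neighbour \<open>y\<close>
  besides its successor. By maximality \<open>y\<close> is on the path, which closes a
  cycle.\<close>

lemma forest_on_undirected_forest:
  assumes "undirected_forest F"
  shows "forest_on (pverts F) (parcs F)"
proof -
  interpret pair_graph F using assms by (simp add: undirected_forest_def)
  let ?W = "pverts F" and ?E = "parcs F"
  have sub: "?E \<subseteq> ?W \<times> ?W" using in_arcsD1 in_arcsD2 by auto
  have sym: "sym ?E" using pair_sym_arcs by (auto simp: symmetric_def)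
  have irr: "irrefl ?E" using pair_no_loops by (force simp: irrefl_def)
  have "\<exists>v\<in>A. card (?E `` {v} \<inter> A) \<le> 1" if A: "A \<subseteq> ?W" "A \<noteq> {}" for A
  proof (rule ccontr)
    assume "\<not> ?thesis"
    then have two: "\<And>v. v \<in> A \<Longrightarrow> 2 \<le> card (?E `` {v} \<inter> A)" by force
    have finA: "finite A" using A pair_finite_verts finite_subset by blast
    define P where "P xs \<longleftrightarrow> xs \<noteq> [] \<and> distinct xs \<and> set xs \<subseteq> A \<and> successively (\<lambda>a b. (a, b) \<in> ?E) xs"
      for xs
    obtain a where "a \<in> A" using A by blast
    then have "P [a]" by (simp add: P_def)
    moreover have "length xs \<le> card A" if "P xs" for xs
      using that finA by (metis P_def card_mono distinct_card)
    ultimately obtain xs where xs: "P xs" "\<And>zs. P zs \<Longrightarrow> length zs \<le> length xs"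
      by (metis ex_has_greatest_nat le_imp_less_Suc)
    then obtain x ys where xys: "xs = x # ys" by (cases xs) (auto simp: P_def)
    have "x \<in> A" using xs xys by (auto simp: P_def)
    \<comment> \<open>\<open>take 1 ys\<close> holds the successor of \<open>x\<close>, and is empty
      if the path is a single vertex.\<close>
    have "\<exists>y \<in> ?E `` {x} \<inter> A. y \<notin> set (take 1 ys)"
    proof (rule ccontr)
      assume "\<not> ?thesis"
      then have "?E `` {x} \<inter> A \<subseteq> set (take 1 ys)" by blast
      then have "card (?E `` {x} \<inter> A) \<le> card (set (take 1 ys))" by (intro card_mono) auto
      also have "\<dots> \<le> length (take 1 ys)" by (rule card_length)
      also have "\<dots> \<le> 1" by simp
      finally show False using two[OF \<open>x \<in> A\<close>] by simp
    qed
    then obtain y where y: "(x, y) \<in> ?E" "y \<in> A" "y \<notin> set (take 1 ys)" by blast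
    have "y \<in> set xs"
    proof (rule ccontr)
      assume "y \<notin> set xs"
      then have "P (y # xs)" using xs(1) xys y symD[OF sym y(1)] by (simp add: P_def)
      then show False using xs(2)[of "y # xs"] by simp
    qed
    then have "y \<in> set ys" using y(1) irr xys by (auto simp: irrefl_def)
    then obtain as bs where ys: "ys = as @ y # bs" by (auto simp: in_set_conv_decomp)
    \<comment> \<open>Since \<open>y\<close> is not the successor of \<open>x\<close>, the closed
      walk has at least three arcs.\<close>
    then have "as \<noteq> []" using y(3) by (cases as) auto
    let ?c = "as @ [y, x]"
    have "successively (\<lambda>a b. (a, b) \<in> ?E) (x # as @ y # bs)"
      using xs(1) xys ys by (simp add: P_def)
    then have "successively (\<lambda>a b. (a, b) \<in> ?E) ((x # as) @ [y, x])"
      using symD[OF sym y(1)] by (simp only: successively_append_iff append_Cons[symmetric]) auto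
    then have "successively (\<lambda>a b. (a, b) \<in> ?E) (x # ?c)" by simp
    note walk = walk_of_vertex_list[OF this]
    have "cycle (zip (x # ?c) ?c)"
      unfolding cycle_def awalk_def
      using walk \<open>x \<in> A\<close> A xs(1) xys ys by (intro exI[of _ x]) (auto simp: P_def)
    moreover have "3 \<le> length (zip (x # ?c) ?c)" using \<open>as \<noteq> []\<close> by (cases as) auto
    ultimately show False using assms unfolding undirected_forest_def by blast
  qed
  then show ?thesis unfolding forest_on_def using sub sym irr pair_finite_verts by blast
qed

section \<open>Perfect matchings and transfer to graphs\<close>

lemma deg_eq_card_Image: "deg G v = card (parcs G `` {v})"
proof -
  have "out_arcs (with_proj G) v = Pair v ` (parcs G `` {v})" by (auto simp: out_arcs_def)
  then show ?thesis unfolding out_degree_def by (simp add: card_image inj_on_def)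
qed

text \<open>The two-element vertex sets of the edges form the partition; the two arcs of an edge
  give the same set.\<close>

lemma disjoint_K2s_if_one_regular:
  assumes "pair_graph G" and reg: "\<And>x. x \<in> pverts G \<Longrightarrow> card (parcs G `` {x}) = 1"
  shows "even (card (pverts G))" "disjoint_K2s (card (pverts G) div 2) G"
proof -
  interpret pair_graph G by (rule assms(1))
  let ?V = "pverts G" and ?R = "parcs G"
  have sym: "sym ?R" using pair_sym_arcs by (auto simp: symmetric_def)
  have ne: "x \<noteq> y" if "(x, y) \<in> ?R" for x y using pair_no_loops[OF that] by simp
  have uniq: "y = z" if "(x, y) \<in> ?R" "(x, z) \<in> ?R" for x y z
  proof -
    have "card (?R `` {x}) = 1" using reg in_arcsD1[OF that(1)] .
    then obtain w where "?R `` {x} = {w}" by (rule card_1_singletonE)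
    then show ?thesis using that by (metis Image_singleton_iff singletonD)
  qed
  have ex: "\<exists>y. (x, y) \<in> ?R" if "x \<in> ?V" for x
    using reg[OF that] by (metis Image_singleton_iff card_1_singletonE insertI1)
  define P where "P = (\<lambda>(x, y). {x, y}) ` ?R"
  have part: "partition_on ?V P"
  proof (rule partition_onI)
    show "\<Union> P = ?V" using ex in_arcsD1 in_arcsD2 by (fastforce simp: P_def)
    show "disjnt p q" if "p \<in> P" "q \<in> P" "p \<noteq> q" for p q
    proof -
      obtain a b c d where "p = {a, b}" "q = {c, d}" "(a, b) \<in> ?R" "(c, d) \<in> ?R"
        using \<open>p \<in> P\<close> \<open>q \<in> P\<close> by (auto simp: P_def)
      then show ?thesis using \<open>p \<noteq> q\<close> uniq symD[OF sym] unfolding disjnt_def by blast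
    qed
  qed (auto simp: P_def)
  have two: "card S = 2" if "S \<in> P" for S using that ne by (auto simp: P_def)
  have "pairwise disjnt P" using partition_onD2[OF part] by (auto simp: disjoint_def pairwise_def disjnt_def)
  then have "card (\<Union> P) = sum card P" by (rule card_Union_disjoint) (auto simp: P_def)
  then have "card ?V = sum card P" using partition_onD1[OF part] by simp
  also have "\<dots> = 2 * card P" using two by simp
  finally have c: "card ?V = 2 * card P" .
  then show "even (card ?V)" by simp
  have "?R = {(u, v). u \<noteq> v \<and> (\<exists>S\<in>P. u \<in> S \<and> v \<in> S)}"
    using ne symD[OF sym] by (fastforce simp: P_def)
  then show "disjoint_K2s (card ?V div 2) G"
    unfolding disjoint_K2s_def using part two c by (intro exI[of _ P]) auto
qed

theorem theorem1p5:
  fixes G :: "'a pair_pre_digraph" and F :: "'b pair_pre_digraph" and n :: nat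
  assumes "pair_graph G" and "undirected_forest F"
    and "card (pverts G) = n" and "card (pverts F) = n"
    and "3 * max_deg G + excess_leaves F \<le> n"
    and "\<not> (even n \<and> disjoint_K2s (n div 2) G \<and> complete_bipartite_digraph 1 (n - 1) (with_proj F))"
  shows "packs G F"
proof -
  interpret G: pair_graph G by (rule assms(1))
  let ?V = "pverts G" and ?W = "pverts F" and ?E = "parcs F"
  have forest: "forest_on ?W ?E" using assms(2) by (rule forest_on_undirected_forest)
  have finW: "finite ?W" using forest by (rule forest_onD)
  obtain h where h: "bij_betw h ?W ?V"
    using finite_same_card_bij[OF finW G.pair_finite_verts] assms(3,4) by auto
  \<comment> \<open>The pullback of \<open>G\<close> along \<open>h\<close> serves as host on the
    vertices of \<open>F\<close>.\<close>
  define R where "R = {(x, y). x \<in> ?W \<and> y \<in> ?W \<and> (h x, h y) \<in> parcs G}"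
  have degR: "card (R `` {x}) = card (parcs G `` {h x})" if "x \<in> ?W" for x
  proof (rule bij_betw_same_card[of h], rule bij_betw_subset[OF h, of _ "parcs G `` {h x}"])
    show "R `` {x} \<subseteq> ?W" by (auto simp: R_def)
    have "y \<in> h ` (R `` {x})" if y: "(h x, y) \<in> parcs G" for y
    proof -
      have "y \<in> ?V" using G.in_arcsD2[OF y] .
      then obtain z where "z \<in> ?W" "h z = y" using h by (metis bij_betw_imp_surj_on imageE)
      then show ?thesis using y \<open>x \<in> ?W\<close> by (auto simp: R_def)
    qed
    then show "h ` (R `` {x}) = parcs G `` {h x}" by (auto simp: R_def)
  qed
  interpret packing_host ?W R "max_deg G"
  proof
    show "R \<subseteq> ?W \<times> ?W" by (auto simp: R_def)
    show "sym R" using G.pair_sym_arcs by (auto simp: R_def sym_def symmetric_def)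
    show "card (R `` {x}) \<le> max_deg G" if "x \<in> ?W" for x
    proof -
      have "deg G (h x) \<le> max_deg G"
        unfolding max_deg_def using G.pair_finite_verts that h by (intro Max_ge) (auto dest: bij_betwE)
      then show ?thesis using degR[OF that] by (simp add: deg_eq_card_Image)
    qed
  qed (rule finW)
  have "admissible ?E"
    using forest assms(4,5) by (simp add: admissible_def excess_def excess_leaves_def deg_eq_card_Image)
  then consider "packable ?E" | c where "c \<in> ?W" "?E = star_at c" "\<forall>x\<in>?W. card (R `` {x}) = 1"
    using packable_or_star by blast
  then show ?thesis
  proof cases
    case 1
    then obtain f where f: "bij_betw f ?W ?W" "\<And>x y. (x, y) \<in> ?E \<Longrightarrow> (f x, f y) \<notin> R"
      unfolding packable_def by blast
    define g where "g = h \<circ> f"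
    have g: "bij_betw g ?W ?V" unfolding g_def using f(1) h by (rule bij_betw_trans)
    \<comment> \<open>\<open>packs\<close> wants a map from \<open>G\<close> to \<open>F\<close>,
      hence the inverse of \<open>g\<close>.\<close>
    have "(inv_into ?W g a, inv_into ?W g b) \<notin> ?E" if ab: "(a, b) \<in> parcs G" for a b
    proof
      assume E: "(inv_into ?W g a, inv_into ?W g b) \<in> ?E"
      have "g (inv_into ?W g a) = a" "g (inv_into ?W g b) = b"
        using g G.in_arcsD1[OF ab] G.in_arcsD2[OF ab] by (simp_all add: bij_betw_inv_into_right)
      moreover have "f (inv_into ?W g a) \<in> ?W" "f (inv_into ?W g b) \<in> ?W"
        using f(1) forest_onD(7)[OF forest E] by (auto dest: bij_betwE)
      ultimately show False using f(2)[OF E] ab by (auto simp: R_def g_def)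
    qed
    then show ?thesis
      unfolding packs_def using bij_betw_inv_into[OF g] by (intro exI[of _ "inv_into ?W g"]) auto
  next
    case (2 c)
    have "card (parcs G `` {x}) = 1" if "x \<in> ?V" for x
      using that 2(3) degR h by (metis bij_betw_imp_surj_on imageE)
    then have "even n" "disjoint_K2s (n div 2) G"
      using disjoint_K2s_if_one_regular[OF assms(1)] assms(3) by auto
    moreover have "complete_bipartite_digraph 1 (n - 1) (with_proj F)"
      unfolding complete_bipartite_digraph_pair_def
    proof (intro conjI exI)
      show "?W = {c} \<union> (?W - {c})" "{c} \<inter> (?W - {c}) = {}" "card {c} = 1" using 2(1) by auto
      show "card (?W - {c}) = n - 1" using 2(1) assms(4) by simp
      show "?E = {c} \<times> (?W - {c}) \<union> (?W - {c}) \<times> {c}" using 2(2) unfolding star_at_def .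
    qed (rule finW)
    ultimately show ?thesis using assms(6) by blast
  qed
qed

end
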